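(* Let $T$ be a tolerance on $U$ induced by an irredundant covering of $U$ and let $E$ be an equivalence on $U$ such that $T$ is $E$-compatible. Suppose that for each $x \in \Sigma_E \setminus \Sigma_T$ such that $T(x)$ is a $T$-block, there exists an element $y \notin \Sigma_E$ with $T(y) = T(x)$. Then \[ (\mathit{RS}(E,T),\vee,\wedge,{}^*,{}^+,(\emptyset,\emptyset),(U,U)) \] is a regular double $p$-algebra, where $\vee,\wedge$ are the lattice operations of $\mathit{RS}(E,T)$ ordered by coordinatewise inclusion, ${}^*$ is the pseudocomplement operation and ${}^+$ is the dual pseudocomplement operation.
   Context: A tolerance is a reflexive and symmetric binary relation. For a binary relation $R$ on $U$ and $x \in U$, $R(x) = \{y \in U \mid x \, R \, y\}$; for an equivalence $E$, $[x]_E = E(x)$. For $X \subseteq U$, $X_R = \{x \in U \mid R(x) \subseteq X\}$ and $X^R = \{x \in U \mid R(x) \cap X \neq \emptyset\}$. With $E \circ T = \{(x,y) \mid (\exists z)\ x \, E \, z \text{ and } z \, T \, y\}$, $T$ is $E$-compatible if $E \circ T \subseteq T$. A covering of $U$ is a collection $\mathcal{C}$ of nonempty subsets of $U$ with $\bigcup \mathcal{C} = U$; it is irredundant if $\mathcal{C} \setminus \{B\}$ is not a covering of $U$ for any $B \in \mathcal{C}$. The tolerance induced by $\mathcal{C}$ is $\{(x,y) \mid (\exists B \in \mathcal{C})\ x,y \in B\}$. A $T$-preblock is a nonempty $X \subseteq U$ with $X \times X \subseteq T$; a $T$-block is a $T$-preblock maximal with respect to inclusion. Put $\Sigma_E =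 \{x \in U \mid [x]_E = \{x\}\}$ and $\Sigma_T = \{x \in U \mid T(x) = \{x\}\}$. $\mathit{RS}(E,T) = \{(X_E,X^T) \mid X \subseteq U\}$, ordered by coordinatewise inclusion. A double $p$-algebra $(L,\vee,\wedge,{}^*,{}^+,0,1)$ is a bounded lattice such that for all $a,b \in L$: $a \wedge b = 0$ iff $b \leq a^*$, and $a \vee b = 1$ iff $b \geq a^+$. It is regular if $a^* = b^*$ and $a^+ = b^+$ imply $a = b$. *)

theory Defs
  imports "HOL-Algebra.Lattice"
begin

section \<open>Tolerances, coverings and blocks\<close>

text \<open>
  All notions are relative to a carrier set \<open>U\<close>; the neighbourhood \<open>R(x)\<close> of a point is the
  relational image \<open>R `` {x}\<close>. The library's \<^const>\<open>refl_on\<close> does not bound the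
  relation by the carrier, hence the explicit inclusion.
\<close>

definition tolerance_on :: "'a set \<Rightarrow> 'a rel \<Rightarrow> bool" where
  "tolerance_on U T \<longleftrightarrow> T \<subseteq> U \<times> U \<and> refl_on U T \<and> sym T"

definition compatible :: "'a rel \<Rightarrow> 'a rel \<Rightarrow> bool" where
  "compatible E T \<longleftrightarrow> E O T \<subseteq> T"

definition covering :: "'a set \<Rightarrow> 'a set set \<Rightarrow> bool" where
  "covering U C \<longleftrightarrow> (\<forall>B\<in>C. B \<noteq> {} \<and> B \<subseteq> U) \<and> \<Union>C = U"

definition irredundant_covering :: "'a set \<Rightarrow> 'a set set \<Rightarrow> bool" where
  "irredundant_covering U C \<longleftrightarrow> covering U C \<and> (\<forall>B\<in>C. \<not> covering U (C - {B}))"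

definition induced_tolerance :: "'a set set \<Rightarrow> 'a rel" where
  "induced_tolerance C = {(x, y). \<exists>B\<in>C. x \<in> B \<and> y \<in> B}"

definition preblock :: "'a set \<Rightarrow> 'a rel \<Rightarrow> 'a set \<Rightarrow> bool" where
  "preblock U T X \<longleftrightarrow> X \<noteq> {} \<and> X \<subseteq> U \<and> X \<times> X \<subseteq> T"

definition block :: "'a set \<Rightarrow> 'a rel \<Rightarrow> 'a set \<Rightarrow> bool" where
  "block U T X \<longleftrightarrow> preblock U T X \<and> (\<forall>Y. preblock U T Y \<and> X \<subseteq> Y \<longrightarrow> Y = X)"

definition Sigma_pts :: "'a set \<Rightarrow> 'a rel \<Rightarrow> 'a set" where
  "Sigma_pts U R = {x \<in> U. R `` {x} = {x}}"


section \<open>Rough sets\<close>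

definition lower_approx :: "'a set \<Rightarrow> 'a rel \<Rightarrow> 'a set \<Rightarrow> 'a set" where
  "lower_approx U R X = {x \<in> U. R `` {x} \<subseteq> X}"

definition upper_approx :: "'a set \<Rightarrow> 'a rel \<Rightarrow> 'a set \<Rightarrow> 'a set" where
  "upper_approx U R X = {x \<in> U. R `` {x} \<inter> X \<noteq> {}}"

definition RS :: "'a set \<Rightarrow> 'a rel \<Rightarrow> 'a rel \<Rightarrow> ('a set \<times> 'a set) set" where
  "RS U E T = {(lower_approx U E X, upper_approx U T X) | X. X \<subseteq> U}"

definition RS_order :: "'a set \<Rightarrow> 'a rel \<Rightarrow> 'a rel \<Rightarrow> ('a set \<times> 'a set) gorder" where
  "RS_order U E T =
     \<lparr>carrier = RS U E T, eq = (=), le = (\<lambda>p q. fst p \<subseteq> fst q \<and> snd p \<subseteq> snd q)\<rparr>"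


section \<open>Regular double p-algebras\<close>

text \<open>
  A bounded lattice is given by its order; its operations are the library's \<open>\<squnion>\<close> and
  \<open>\<sqinter>\<close>. The remaining operations and constants are explicit parameters:
  \<open>pc\<close> is \<open>a \<mapsto> a\<^sup>*\<close>, \<open>dpc\<close> is \<open>a \<mapsto> a\<^sup>+\<close>.
\<close>

locale double_p_algebra = bounded_lattice L for L (structure) +
  fixes pc dpc :: "'a \<Rightarrow> 'a" and zero one :: 'a
  assumes zero_eq: "zero = \<bottom>"
    and one_eq: "one = \<top>"
    and pc_closed: "a \<in> carrier L \<Longrightarrow> pc a \<in> carrier L"
    and dpc_closed: "a \<in> carrier L \<Longrightarrow> dpc a \<in> carrier L"
    and pc_iff: "a \<in> carrier L \<Longrightarrow> b \<in> carrier L \<Longrightarrow> a \<sqinter> b = zero \<longleftrightarrow> b \<sqsubseteq> pc a"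
    and dpc_iff: "a \<in> carrier L \<Longrightarrow> b \<in> carrier L \<Longrightarrow> a \<squnion> b = one \<longleftrightarrow> dpc a \<sqsubseteq> b"

locale regular_double_p_algebra = double_p_algebra +
  assumes regular:
    "a \<in> carrier L \<Longrightarrow> b \<in> carrier L \<Longrightarrow> pc a = pc b \<Longrightarrow> dpc a = dpc b \<Longrightarrow> a = b"

text \<open>
  The pseudocomplement operations determined by an order, selected with \<open>SOME\<close> like the
  library's \<open>\<squnion>\<close> and \<open>\<sqinter>\<close>; meaningful only where the extremal element exists.
\<close>

definition pseudocomplement :: "('a, 'm) gorder_scheme \<Rightarrow> 'a \<Rightarrow> 'a" where
  "pseudocomplement L a =
     (SOME g. greatest L g {b \<in> carrier L. a \<sqinter>\<^bsub>L\<^esub> b = \<bottom>\<^bsub>L\<^esub>})"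

definition dual_pseudocomplement :: "('a, 'm) gorder_scheme \<Rightarrow> 'a \<Rightarrow> 'a" where
  "dual_pseudocomplement L a =
     (SOME l. least L l {b \<in> carrier L. a \<squnion>\<^bsub>L\<^esub> b = \<top>\<^bsub>L\<^esub>})"

end

theory Submission
  imports Defs
begin

text \<open>
  By irredundance each member \<open>B\<close> of the covering has a private point \<open>x\<close>, so
  \<open>T(x) = B\<close> is a block and a union of members of the covering determines which
  members it contains. Together with the hypothesis on singleton classes this identifies
  \<open>RS(E,T)\<close> with the pairs \<open>(A,Z)\<close> where \<open>A\<close> is \<open>E\<close>-closed, \<open>Z\<close> is a union of members of
  the covering that contains every member meeting \<open>A\<close>, and \<open>Z \<inter> \<Sigma>\<^sub>T \<subseteq> A\<close>.
  On such pairs \<open>(A,Z)\<^sup>* = (U - Z, (U - Z)\<^sup>T)\<close> depends only on, and determines, \<open>Z\<close>,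
  and likewise \<open>(A,Z)\<^sup>+ = (U - A, (U - A)\<^sup>T)\<close> determines \<open>A\<close>; hence regularity.
\<close>

section \<open>Extremal elements of partial orders\<close>

context partial_order
begin

text \<open>Uniqueness of extremal elements turns each \<open>SOME\<close> choice into an equation;
  joins, meets, bounds and pseudocomplements are all computed this way.\<close>

lemma Some_least_eq: "least L x A \<Longrightarrow> (SOME y. least L y A) = x"
  by (rule some_equality) (use weak_least_unique eq_is_equal in auto)

lemma Some_greatest_eq: "greatest L x A \<Longrightarrow> (SOME y. greatest L y A) = x"
  by (rule some_equality) (use weak_greatest_unique eq_is_equal in auto)

lemma join_eqI: "is_lub L s {x, y} \<Longrightarrow> x \<squnion> y = s"
  unfolding join_def sup_def by (rule Some_least_eq)

lemma meet_eqI: "is_glb L s {x, y} \<Longrightarrow> x \<sqinter> y = s"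
  unfolding meet_def inf_def by (rule Some_greatest_eq)

lemma bottom_eqI: "least L x (carrier L) \<Longrightarrow> \<bottom> = x"
  unfolding bottom_def by (rule Some_least_eq)

lemma top_eqI: "greatest L x (carrier L) \<Longrightarrow> \<top> = x"
  unfolding top_def by (rule Some_greatest_eq)

text \<open>The assumed equivalence has the form of the double p-algebra axiom, so one proof of it
  yields both the value of the operation and the axiom.\<close>

lemma pseudocomplement_eqI:
  assumes "c \<in> carrier L" "\<And>b. b \<in> carrier L \<Longrightarrow> a \<sqinter> b = \<bottom> \<longleftrightarrow> b \<sqsubseteq> c"
  shows "pseudocomplement L a = c"
  unfolding pseudocomplement_def
  by (rule Some_greatest_eq) (use assms in \<open>auto simp: greatest_def\<close>)

lemma dual_pseudocomplement_eqI:
  assumes "c \<in> carrier L" "\<And>b. b \<in> carrier L \<Longrightarrow> a \<squnion> b = \<top> \<longleftrightarrow> c \<sqsubseteq> b"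
  shows "dual_pseudocomplement L a = c"
  unfolding dual_pseudocomplement_def
  by (rule Some_least_eq) (use assms in \<open>auto simp: least_def\<close>)

end

lemma RS_order_simps [simp]:
  "carrier (RS_order U E T) = RS U E T"
  "eq (RS_order U E T) = (=)"
  "le (RS_order U E T) p q \<longleftrightarrow> fst p \<subseteq> fst q \<and> snd p \<subseteq> snd q"
  by (simp_all add: RS_order_def)

lemma partial_order_RS: "partial_order (RS_order U E T)"
  by unfold_locales (auto simp: prod_eq_iff)


section \<open>Rough sets of a compatible irredundant covering\<close>

locale irredundant_rough_sets =
  fixes U :: "'a set" and T E :: "'a rel" and C :: "'a set set"
  assumes irredundant: "irredundant_covering U C"
    and T_eq: "T = induced_tolerance C"
    and equiv: "equiv U E"
    and compat: "compatible E T"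
    and singleton_class: "\<And>x. x \<in> Sigma_pts U E - Sigma_pts U T \<Longrightarrow> block U T (T `` {x}) \<Longrightarrow>
           \<exists>y\<in>U. y \<notin> Sigma_pts U E \<and> T `` {y} = T `` {x}"
begin

section \<open>Members of the covering: private points, blocks and saturation\<close>

lemma cover_nonempty: "B \<in> C \<Longrightarrow> B \<noteq> {}"
  and cover_subset: "B \<in> C \<Longrightarrow> B \<subseteq> U"
  and cover_Union: "\<Union>C = U"
  using irredundant by (auto simp: irredundant_covering_def covering_def)

text \<open>Irredundance leaves a point of \<open>B\<close> in no other member; every
  \<open>T\<close>-neighbour shares a member with it, necessarily \<open>B\<close>.\<close>

lemma private_point:
  assumes "B \<in> C"
  obtains x where "x \<in> B" "T `` {x} = B"
proof -
  have "\<Union>(C - {B}) \<noteq> U"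
    using irredundant assms unfolding irredundant_covering_def covering_def by blast
  then obtain x where "x \<in> U" "x \<notin> \<Union>(C - {B})"
    using cover_Union by blast
  with that[of x] show thesis
    using cover_Union assms unfolding T_eq induced_tolerance_def by blast
qed

text \<open>A preblock above \<open>B\<close> contains a private point \<open>x\<close> of
  \<open>B\<close>, hence lies in \<open>T(x) = B\<close>.\<close>

lemma block_cover:
  assumes "B \<in> C"
  shows "block U T B"
proof -
  obtain x where x: "x \<in> B" "T `` {x} = B"
    using assms by (rule private_point)
  have "preblock U T B"
    using assms cover_nonempty cover_subset
    by (auto simp: preblock_def T_eq induced_tolerance_def)
  moreover have "Y = B" if "preblock U T Y" "B \<subseteq> Y" for Y
    using that x by (auto simp: preblock_def)
  ultimately show ?thesis
    unfolding block_def by blast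
qed

lemma E_in_U: "(x, y) \<in> E \<Longrightarrow> x \<in> U \<and> y \<in> U"
  using equiv by (auto simp: equiv_def)

lemma E_refl: "x \<in> U \<Longrightarrow> (x, x) \<in> E"
  using equiv by (auto simp: equiv_def refl_on_def)

lemma E_sym: "(x, y) \<in> E \<Longrightarrow> (y, x) \<in> E"
  using equiv by (auto simp: equiv_def dest: symD)

lemma E_trans: "(x, y) \<in> E \<Longrightarrow> (y, z) \<in> E \<Longrightarrow> (x, z) \<in> E"
  using equiv by (auto simp: equiv_def dest: transD)

text \<open>Compatibility gives \<open>T(y) \<subseteq> T(x)\<close>; symmetry of \<open>E\<close>
  gives the converse.\<close>

lemma T_class_eq: "(x, y) \<in> E \<Longrightarrow> T `` {x} = T `` {y}"
  using compat E_sym unfolding compatible_def by blast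

text \<open>A private point of \<open>B\<close> is a neighbour of \<open>x\<close>, hence of
  \<open>y\<close>, and all its neighbours lie in \<open>B\<close>. So members are unions of
  \<open>E\<close>-classes.\<close>

lemma cover_saturated:
  assumes "B \<in> C" "x \<in> B" "(x, y) \<in> E"
  shows "y \<in> B"
proof -
  obtain b where b: "b \<in> B" "T `` {b} = B"
    using assms(1) by (rule private_point)
  have "b \<in> T `` {x}"
    using assms b by (auto simp: T_eq induced_tolerance_def)
  then have "b \<in> T `` {y}"
    using T_class_eq[OF assms(3)] by simp
  then show ?thesis
    using b by (auto simp: T_eq induced_tolerance_def)
qed

lemma upper_approx_eq: "upper_approx U T X = \<Union>{B \<in> C. B \<inter> X \<noteq> {}}"
  using cover_Union unfolding upper_approx_def T_eq induced_tolerance_def by blast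

text \<open>A private point \<open>x\<close> of \<open>B\<close> serves as \<open>y\<close> if its
  class is not a singleton, and as \<open>d\<close> if it lies in \<open>Sigma_pts U T\<close>.
  Otherwise \<open>T(x)\<close> is a block to which \<open>singleton_class\<close> applies.\<close>

lemma cover_cases:
  assumes "B \<in> C"
  obtains y where "y \<in> U" "y \<notin> Sigma_pts U E" "T `` {y} = B"
  | d where "d \<in> Sigma_pts U T" "B = {d}"
proof -
  obtain x where x: "x \<in> B" "T `` {x} = B"
    using assms by (rule private_point)
  then have "x \<in> U" "block U T (T `` {x})"
    using block_cover cover_subset assms by auto
  then show thesis
    using singleton_class[of x] that x unfolding Sigma_pts_def by blast
qed

section \<open>Intrinsic description of the rough sets\<close>

definition rough_pair :: "'a set \<Rightarrow> 'a set \<Rightarrow> bool" where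
  "rough_pair A Z \<longleftrightarrow> A \<subseteq> U \<and> E `` A \<subseteq> A \<and> (\<forall>z\<in>Z. \<exists>B\<in>C. z \<in> B \<and> B \<subseteq> Z) \<and>
     (\<forall>B\<in>C. B \<inter> A \<noteq> {} \<longrightarrow> B \<subseteq> Z) \<and> Z \<inter> Sigma_pts U T \<subseteq> A"

lemma rough_pair_approx:
  assumes "X \<subseteq> U"
  shows "rough_pair (lower_approx U E X) (upper_approx U T X)"
  unfolding rough_pair_def
proof (intro conjI)
  show "lower_approx U E X \<subseteq> U"
    by (auto simp: lower_approx_def)
  show "E `` lower_approx U E X \<subseteq> lower_approx U E X"
    using E_in_U E_trans unfolding lower_approx_def by blast
  show "\<forall>z\<in>upper_approx U T X. \<exists>B\<in>C. z \<in> B \<and> B \<subseteq> upper_approx U T X"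
    unfolding upper_approx_eq by blast
  have "lower_approx U E X \<subseteq> X"
    using E_refl unfolding lower_approx_def by blast
  then show "\<forall>B\<in>C. B \<inter> lower_approx U E X \<noteq> {} \<longrightarrow> B \<subseteq> upper_approx U T X"
    unfolding upper_approx_eq by blast
  show "upper_approx U T X \<inter> Sigma_pts U T \<subseteq> lower_approx U E X"
  proof
    fix x
    assume "x \<in> upper_approx U T X \<inter> Sigma_pts U T"
    then have x: "x \<in> U" "T `` {x} = {x}" "x \<in> X"
      by (auto simp: upper_approx_def Sigma_pts_def)
    \<comment> \<open>The class of \<open>x\<close> stays inside every member through
      \<open>x\<close>, and such a member lies in \<open>T(x) = {x}\<close>.\<close>
    have "y = x" if "(x, y) \<in> E" for y
    proof -
      obtain B where B: "B \<in> C" "x \<in> B"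
        using x(1) cover_Union by blast
      then have "y \<in> B"
        using cover_saturated that by blast
      with B have "(x, y) \<in> T"
        unfolding T_eq induced_tolerance_def by blast
      with x(2) show ?thesis by blast
    qed
    then show "x \<in> lower_approx U E X"
      using x unfolding lower_approx_def by blast
  qed
qed

text \<open>
  Adding to \<open>A\<close> one representative of a non-singleton class completes no class outside \<open>A\<close>,
  so the lower approximation stays \<open>A\<close>, while the upper approximation grows to \<open>Z\<close>.
\<close>

lemma rough_pair_realized:
  assumes "rough_pair A Z"
  shows "(A, Z) \<in> RS U E T"
proof -
  note rp = assms[unfolded rough_pair_def]
  then have AU: "A \<subseteq> U" and iso: "Z \<inter> Sigma_pts U T \<subseteq> A"
    by simp_all
  have AE: "y \<in> A" if "x \<in> A" "(x, y) \<in> E" for x y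
    using rp that by (elim conjE) blast
  have Zun: "\<exists>B\<in>C. z \<in> B \<and> B \<subseteq> Z" if "z \<in> Z" for z
    using rp that by (elim conjE) (erule bspec)
  have AZ: "B \<subseteq> Z" if "B \<in> C" "B \<inter> A \<noteq> {}" for B
    using rp that by (elim conjE) simp
  \<comment> \<open>Related points define the same predicate, so the choice is constant on
    classes.\<close>
  define r where "r x = (SOME y. (x, y) \<in> E)" for x
  have rE: "(x, r x) \<in> E" if "x \<in> U" for x
    unfolding r_def using E_refl[OF that] by (rule someI)
  have r_eq: "r x = r y" if "(x, y) \<in> E" for x y
  proof -
    have "(\<lambda>z. (x, z) \<in> E) = (\<lambda>z. (y, z) \<in> E)"
      using that E_sym E_trans by blast
    then show ?thesis by (simp add: r_def)
  qed
  \<comment> \<open>The condition \<open>T(y) \<subseteq> Z\<close> keeps the upper approximation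
    inside \<open>Z\<close>; avoiding \<open>Sigma_pts U E\<close> ensures that one representative
    does not fill its class.\<close>
  define G where "G = {y \<in> U - Sigma_pts U E. y \<notin> A \<and> T `` {y} \<subseteq> Z}"
  define X where "X = A \<union> r ` G"
  have XU: "X \<subseteq> U"
    using AU rE E_in_U unfolding X_def G_def by blast
  have "lower_approx U E X = A"
  proof
    show "A \<subseteq> lower_approx U E X"
      using AU AE unfolding lower_approx_def X_def by blast
    show "lower_approx U E X \<subseteq> A"
    proof
      fix x
      assume "x \<in> lower_approx U E X"
      then have x: "x \<in> U" "E `` {x} \<subseteq> X"
        by (auto simp: lower_approx_def)
      show "x \<in> A"
      proof (rule ccontr)
        assume "x \<notin> A"
        \<comment> \<open>The class of \<open>x\<close> misses the \<open>E\<close>-closed set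
          \<open>A\<close>, so it consists of representatives and collapses to \<open>r x\<close>.
          But it is also the class of some \<open>g \<in> G\<close>, which is not a
          singleton.\<close>
        have r_only: "z = r x \<and> z \<in> r ` G" if xz: "(x, z) \<in> E" for z
        proof -
          have "z \<notin> A"
            using \<open>x \<notin> A\<close> AE E_sym xz by blast
          then obtain g where g: "g \<in> G" "z = r g"
            using x xz unfolding X_def by blast
          then have "(g, z) \<in> E"
            using rE by (simp add: G_def)
          then have "r g = r x"
            using r_eq xz by metis
          then show ?thesis
            using g by blast
        qed
        then obtain g where g: "g \<in> G" "x = r g"
          using r_only E_refl x(1) by blast
        have gx: "(g, x) \<in> E"
          using g rE by (simp add: G_def)
        have only_r: "h = r x" if "(g, h) \<in> E" for h
          using r_only E_trans[OF E_sym[OF gx] that] by blast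
        have gU: "g \<in> U"
          using g by (simp add: G_def)
        have "E `` {g} = {g}"
          using only_r only_r[OF E_refl[OF gU]] E_refl[OF gU] by auto
        then show False
          using g(1) by (auto simp: G_def Sigma_pts_def)
      qed
    qed
  qed
  moreover have "upper_approx U T X = Z"
  proof
    show "upper_approx U T X \<subseteq> Z"
    proof
      fix z
      assume "z \<in> upper_approx U T X"
      then obtain B x where B: "B \<in> C" "z \<in> B" "x \<in> B" "x \<in> X"
        unfolding upper_approx_eq by blast
      show "z \<in> Z"
      proof (cases "x \<in> A")
        case True
        then show ?thesis using AZ B by blast
      next
        case False
        then obtain g where g: "g \<in> G" "x = r g"
          using B unfolding X_def by blast
        then have "T `` {x} \<subseteq> Z"
          using T_class_eq rE unfolding G_def by blast
        then show ?thesis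
          using B unfolding T_eq induced_tolerance_def by blast
      qed
    qed
    show "Z \<subseteq> upper_approx U T X"
    proof
      fix z
      assume "z \<in> Z"
      then obtain B where B: "B \<in> C" "z \<in> B" "B \<subseteq> Z"
        using Zun by blast
      \<comment> \<open>Either \<open>B = T(y)\<close> with a non-singleton class, whose
        representative is in \<open>B\<close> by saturation, or \<open>B = {d}\<close> with
        \<open>d\<close> forced into \<open>A\<close> by \<open>iso\<close>.\<close>
      have "B \<inter> X \<noteq> {}"
        using B(1)
      proof (cases rule: cover_cases)
        case (1 y)
        have yB: "y \<in> B"
          using 1 cover_Union unfolding T_eq induced_tolerance_def by blast
        show ?thesis
        proof (cases "y \<in> A")
          case True
          then show ?thesis using yB X_def by blast
        next
          case False
          then have "r y \<in> X"
            using 1 B by (auto simp: X_def G_def)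
          moreover have "r y \<in> B"
            using cover_saturated B(1) yB rE 1(1) by blast
          ultimately show ?thesis by blast
        qed
      next
        case (2 d)
        then show ?thesis using iso B X_def by blast
      qed
      then show "z \<in> upper_approx U T X"
        using B unfolding upper_approx_eq by blast
    qed
  qed
  ultimately show ?thesis
    using XU unfolding RS_def by blast
qed

lemma RS_iff: "p \<in> RS U E T \<longleftrightarrow> rough_pair (fst p) (snd p)"
  using rough_pair_realized[of "fst p" "snd p"] rough_pair_approx unfolding RS_def by auto

lemma saturated_lower: "X \<subseteq> U \<Longrightarrow> E `` X \<subseteq> X \<Longrightarrow> lower_approx U E X = X"
  using E_refl unfolding lower_approx_def by blast

text \<open>An \<open>E\<close>-closed \<open>X\<close> is its own lower approximation, so
  \<open>X\<close> itself realizes the pair. This supplies the bounds and both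
  pseudocomplements.\<close>

lemma saturated_in_RS: "X \<subseteq> U \<Longrightarrow> E `` X \<subseteq> X \<Longrightarrow> (X, upper_approx U T X) \<in> RS U E T"
  unfolding RS_def using saturated_lower[of X] by (intro CollectI exI[of _ X]) simp

lemma saturated_compl: "E `` X \<subseteq> X \<Longrightarrow> E `` (U - X) \<subseteq> U - X"
  using E_in_U E_sym by blast


section \<open>The lattice operations\<close>

text \<open>An intersection of unions of members need not be such a union; the kernel is the largest
  one inside \<open>Z\<close> and replaces the intersection in meets.\<close>

definition cover_kernel :: "'a set \<Rightarrow> 'a set" where
  "cover_kernel Z = \<Union>{B \<in> C. B \<subseteq> Z}"

lemma cover_in_kernel: "B \<in> C \<Longrightarrow> B \<subseteq> Z \<Longrightarrow> B \<subseteq> cover_kernel Z"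
  unfolding cover_kernel_def by blast

lemma cover_kernel_subset: "cover_kernel Z \<subseteq> Z"
  unfolding cover_kernel_def by blast

lemma rough_pairD:
  assumes "p \<in> RS U E T"
  shows "fst p \<subseteq> U" "E `` fst p \<subseteq> fst p"
    "\<And>z. z \<in> snd p \<Longrightarrow> \<exists>B\<in>C. z \<in> B \<and> B \<subseteq> snd p"
    "\<And>B. B \<in> C \<Longrightarrow> B \<inter> fst p \<noteq> {} \<Longrightarrow> B \<subseteq> snd p"
    "snd p \<inter> Sigma_pts U T \<subseteq> fst p"
    "fst p \<subseteq> snd p" "snd p \<subseteq> U"
proof -
  have rp: "rough_pair (fst p) (snd p)"
    using assms RS_iff by blast
  note rp' = rp[unfolded rough_pair_def]
  then show U: "fst p \<subseteq> U" and "E `` fst p \<subseteq> fst p" "snd p \<inter> Sigma_pts U T \<subseteq> fst p"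
    by simp_all
  show *: "\<exists>B\<in>C. z \<in> B \<and> B \<subseteq> snd p" if "z \<in> snd p" for z
    using rp' that by (elim conjE) (erule bspec)
  show **: "B \<subseteq> snd p" if "B \<in> C" "B \<inter> fst p \<noteq> {}" for B
    using rp' that by (elim conjE) simp
  show "fst p \<subseteq> snd p"
    using U ** cover_Union by blast
  show "snd p \<subseteq> U"
    using * cover_Union by blast
qed

lemma snd_saturated:
  assumes "p \<in> RS U E T"
  shows "E `` snd p \<subseteq> snd p"
proof
  fix y assume "y \<in> E `` snd p"
  then obtain x where x: "x \<in> snd p" "(x, y) \<in> E"
    by blast
  then obtain B where "B \<in> C" "x \<in> B" "B \<subseteq> snd p"
    using rough_pairD(3)[OF assms] by blast
  then show "y \<in> snd p"
    using cover_saturated x(2) by blast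
qed

lemma join_in_RS:
  assumes "p \<in> RS U E T" "q \<in> RS U E T"
  shows "(fst p \<union> fst q, snd p \<union> snd q) \<in> RS U E T"
  unfolding RS_iff rough_pair_def fst_conv snd_conv
proof (intro conjI)
  show "\<forall>z\<in>snd p \<union> snd q. \<exists>B\<in>C. z \<in> B \<and> B \<subseteq> snd p \<union> snd q"
  proof
    fix z assume "z \<in> snd p \<union> snd q"
    then obtain B where "B \<in> C" "z \<in> B" "B \<subseteq> snd p \<or> B \<subseteq> snd q"
      using rough_pairD(3) assms by (metis UnE)
    then show "\<exists>B\<in>C. z \<in> B \<and> B \<subseteq> snd p \<union> snd q" by blast
  qed
  show "\<forall>B\<in>C. B \<inter> (fst p \<union> fst q) \<noteq> {} \<longrightarrow> B \<subseteq> snd p \<union> snd q"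
  proof (intro ballI impI)
    fix B assume "B \<in> C" "B \<inter> (fst p \<union> fst q) \<noteq> {}"
    then show "B \<subseteq> snd p \<union> snd q"
      using rough_pairD(4)[OF assms(1), of B] rough_pairD(4)[OF assms(2), of B] by blast
  qed
  show "fst p \<union> fst q \<subseteq> U"
    using assms rough_pairD(1) by simp
  show "E `` (fst p \<union> fst q) \<subseteq> fst p \<union> fst q"
    using rough_pairD(2)[OF assms(1)] rough_pairD(2)[OF assms(2)] unfolding Image_Un by blast
  show "(snd p \<union> snd q) \<inter> Sigma_pts U T \<subseteq> fst p \<union> fst q"
    using rough_pairD(5)[OF assms(1)] rough_pairD(5)[OF assms(2)] by blast
qed

lemma meet_in_RS:
  assumes "p \<in> RS U E T" "q \<in> RS U E T"
  shows "(fst p \<inter> fst q, cover_kernel (snd p \<inter> snd q)) \<in> RS U E T"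
  unfolding RS_iff rough_pair_def fst_conv snd_conv
proof (intro conjI)
  show "\<forall>z\<in>cover_kernel (snd p \<inter> snd q). \<exists>B\<in>C. z \<in> B \<and> B \<subseteq> cover_kernel (snd p \<inter> snd q)"
    unfolding cover_kernel_def by blast
  show "\<forall>B\<in>C. B \<inter> (fst p \<inter> fst q) \<noteq> {} \<longrightarrow> B \<subseteq> cover_kernel (snd p \<inter> snd q)"
  proof (intro ballI impI)
    fix B assume "B \<in> C" "B \<inter> (fst p \<inter> fst q) \<noteq> {}"
    then show "B \<subseteq> cover_kernel (snd p \<inter> snd q)"
      using rough_pairD(4)[OF assms(1), of B] rough_pairD(4)[OF assms(2), of B]
      by (intro cover_in_kernel) auto
  qed
  show "cover_kernel (snd p \<inter> snd q) \<inter> Sigma_pts U T \<subseteq> fst p \<inter> fst q"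
    using rough_pairD(5)[OF assms(1)] rough_pairD(5)[OF assms(2)]
      cover_kernel_subset[of "snd p \<inter> snd q"] by blast
qed (use rough_pairD(1,2)[OF assms(1)] rough_pairD(1,2)[OF assms(2)] in auto)

abbreviation "L \<equiv> RS_order U E T"

interpretation partial_order L
  by (rule partial_order_RS)

lemma is_lub_RS:
  assumes "p \<in> RS U E T" "q \<in> RS U E T"
  shows "is_lub L (fst p \<union> fst q, snd p \<union> snd q) {p, q}"
  using join_in_RS[OF assms] assms by (auto simp: least_def Upper_def simp del: split_paired_All)

lemma is_glb_RS:
  assumes "p \<in> RS U E T" "q \<in> RS U E T"
  shows "is_glb L (fst p \<inter> fst q, cover_kernel (snd p \<inter> snd q)) {p, q}"
proof (rule greatest_LowerI)
  fix l assume "l \<in> Lower L {p, q}"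
  then have l: "l \<in> RS U E T" "fst l \<subseteq> fst p \<inter> fst q" "snd l \<subseteq> snd p \<inter> snd q"
    using assms by (auto simp: Lower_def simp del: split_paired_All)
  have "snd l \<subseteq> cover_kernel (snd p \<inter> snd q)"
  proof
    fix z assume "z \<in> snd l"
    then obtain B where "B \<in> C" "z \<in> B" "B \<subseteq> snd l"
      using rough_pairD(3)[OF l(1)] by blast
    then show "z \<in> cover_kernel (snd p \<inter> snd q)"
      using l(3) cover_in_kernel[of B] by blast
  qed
  then show "l \<sqsubseteq>\<^bsub>L\<^esub> (fst p \<inter> fst q, cover_kernel (snd p \<inter> snd q))"
    using l by simp
qed (use assms meet_in_RS[OF assms] cover_kernel_subset[of "snd p \<inter> snd q"] in auto)

lemmas join_RS = join_eqI[OF is_lub_RS]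
lemmas meet_RS = meet_eqI[OF is_glb_RS]

lemma least_RS: "least L ({}, {}) (RS U E T)"
  using saturated_in_RS[of "{}"] by (simp add: least_def upper_approx_eq)

lemma greatest_RS: "greatest L (U, U) (RS U E T)"
proof -
  have "upper_approx U T U = U"
    using cover_Union cover_nonempty unfolding upper_approx_eq by blast
  then have "(U, U) \<in> RS U E T"
    using saturated_in_RS[of U] E_in_U by auto
  then show ?thesis
    using rough_pairD(1,7) by (simp add: greatest_def)
qed

lemma bottom_RS: "\<bottom>\<^bsub>L\<^esub> = ({}, {})"
  using bottom_eqI least_RS by simp

lemma top_RS: "\<top>\<^bsub>L\<^esub> = (U, U)"
  using top_eqI greatest_RS by simp

lemma bounded_lattice_RS: "bounded_lattice L"
proof
  fix x y assume "x \<in> carrier L" "y \<in> carrier L"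
  then have "x \<in> RS U E T" "y \<in> RS U E T"
    by simp_all
  then show "\<exists>s. is_lub L s {x, y}" "\<exists>s. is_glb L s {x, y}"
    using is_lub_RS is_glb_RS by blast+
next
  show "\<exists>x. least L x (carrier L)" "\<exists>x. greatest L x (carrier L)"
    using least_RS greatest_RS by auto
qed


section \<open>Pseudocomplements\<close>

lemma pc_in_RS: "p \<in> RS U E T \<Longrightarrow> (U - snd p, upper_approx U T (U - snd p)) \<in> RS U E T"
  by (intro saturated_in_RS saturated_compl snd_saturated) auto

lemma dpc_in_RS: "p \<in> RS U E T \<Longrightarrow> (U - fst p, upper_approx U T (U - fst p)) \<in> RS U E T"
  by (intro saturated_in_RS saturated_compl rough_pairD(2)) auto

lemma meet_bottom_iff:
  assumes p: "p \<in> RS U E T" and q: "q \<in> RS U E T"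
  shows "p \<sqinter>\<^bsub>L\<^esub> q = \<bottom>\<^bsub>L\<^esub> \<longleftrightarrow> q \<sqsubseteq>\<^bsub>L\<^esub> (U - snd p, upper_approx U T (U - snd p))"
    (is "?l \<longleftrightarrow> ?r")
proof -
  have l: "?l \<longleftrightarrow> fst p \<inter> fst q = {} \<and> (\<forall>B\<in>C. \<not> B \<subseteq> snd p \<inter> snd q)"
    using cover_nonempty unfolding meet_RS[OF p q] bottom_RS cover_kernel_def by auto
  show ?thesis
  proof
    assume ?l
    then have *: "\<not> B \<subseteq> snd p \<inter> snd q" if "B \<in> C" for B
      using l that by blast
    \<comment> \<open>A common point \<open>x\<close> of \<open>fst q\<close> and
      \<open>snd p\<close> has a member through it inside \<open>snd p\<close>; meeting
      \<open>fst q\<close>, that member also lies in \<open>snd q\<close>, which \<open>*\<close>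
      forbids.\<close>
    have "fst q \<subseteq> U - snd p"
    proof
      fix x assume x: "x \<in> fst q"
      have "x \<notin> snd p"
      proof
        assume "x \<in> snd p"
        then obtain B where B: "B \<in> C" "x \<in> B" "B \<subseteq> snd p"
          using rough_pairD(3)[OF p] by blast
        with x have "B \<subseteq> snd q"
          using rough_pairD(4)[OF q, of B] by blast
        with B * show False by blast
      qed
      then show "x \<in> U - snd p"
        using x rough_pairD(1)[OF q] by blast
    qed
    moreover have "snd q \<subseteq> upper_approx U T (U - snd p)"
    proof
      fix z assume "z \<in> snd q"
      then obtain B where B: "B \<in> C" "z \<in> B" "B \<subseteq> snd q"
        using rough_pairD(3)[OF q] by blast
      then have "B \<inter> (U - snd p) \<noteq> {}"
        using * cover_subset by blast
      then show "z \<in> upper_approx U T (U - snd p)"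
        using B unfolding upper_approx_eq by blast
    qed
    ultimately show ?r by simp
  next
    assume r: ?r
    \<comment> \<open>By \<open>?r\<close>, a private point \<open>x\<close> of such a
      \<open>B\<close> would have a neighbour outside \<open>snd p\<close>, although
      \<open>T(x) = B \<subseteq> snd p\<close>.\<close>
    have "\<not> B \<subseteq> snd p \<inter> snd q" if B: "B \<in> C" for B
    proof
      assume sub: "B \<subseteq> snd p \<inter> snd q"
      obtain x where x: "x \<in> B" "T `` {x} = B"
        using B by (rule private_point)
      then have "x \<in> upper_approx U T (U - snd p)"
        using r sub by auto
      then show False
        using x sub by (auto simp: upper_approx_def)
    qed
    then show ?l
      using l r rough_pairD(6)[OF p] by auto
  qed
qed

lemma join_top_iff:
  assumes p: "p \<in> RS U E T" and q: "q \<in> RS U E T"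
  shows "p \<squnion>\<^bsub>L\<^esub> q = \<top>\<^bsub>L\<^esub> \<longleftrightarrow> (U - fst p, upper_approx U T (U - fst p)) \<sqsubseteq>\<^bsub>L\<^esub> q"
    (is "?l \<longleftrightarrow> ?r")
proof -
  have l: "?l \<longleftrightarrow> fst p \<union> fst q = U \<and> snd p \<union> snd q = U"
    unfolding join_RS[OF p q] top_RS by auto
  show ?thesis
  proof
    assume ?l
    then have "U - fst p \<subseteq> fst q"
      using l by blast
    moreover from this have "upper_approx U T (U - fst p) \<subseteq> snd q"
      using rough_pairD(4)[OF q] unfolding upper_approx_eq by blast
    ultimately show ?r by simp
  next
    assume r: ?r
    have "U \<subseteq> snd p \<union> snd q"
    proof
      fix u assume "u \<in> U"
      then obtain B where B: "B \<in> C" "u \<in> B" "B \<subseteq> U"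
        using cover_Union by blast
      show "u \<in> snd p \<union> snd q"
      \<comment> \<open>A member meeting \<open>fst p\<close> lies in \<open>snd p\<close>; any
        other lies in the upper approximation of \<open>U - fst p\<close>, hence in
        \<open>snd q\<close>.\<close>
      proof (cases "B \<inter> fst p = {}")
        case True
        then have "u \<in> upper_approx U T (U - fst p)"
          using B unfolding upper_approx_eq by blast
        then show ?thesis using r by auto
      next
        case False
        then show ?thesis using rough_pairD(4)[OF p, of B] B by blast
      qed
    qed
    then show ?l
      using l r rough_pairD(1,7)[OF p] rough_pairD(1,7)[OF q] by auto
  qed
qed

lemma pseudocomplement_RS:
  "p \<in> RS U E T \<Longrightarrow> pseudocomplement L p = (U - snd p, upper_approx U T (U - snd p))"
  by (rule pseudocomplement_eqI) (simp_all add: pc_in_RS meet_bottom_iff del: RS_order_simps(3))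

lemma dual_pseudocomplement_RS:
  "p \<in> RS U E T \<Longrightarrow> dual_pseudocomplement L p = (U - fst p, upper_approx U T (U - fst p))"
  by (rule dual_pseudocomplement_eqI) (simp_all add: dpc_in_RS join_top_iff del: RS_order_simps(3))

lemma regular_double_p_algebra_RS:
  "regular_double_p_algebra L (pseudocomplement L) (dual_pseudocomplement L) ({}, {}) (U, U)"
proof -
  interpret bounded_lattice L
    by (rule bounded_lattice_RS)
  show ?thesis
  proof
    show "({}, {}) = \<bottom>\<^bsub>L\<^esub>" "(U, U) = \<top>\<^bsub>L\<^esub>"
      by (simp_all add: bottom_RS top_RS)
  next
    fix a assume a: "a \<in> carrier L"
    then show "pseudocomplement L a \<in> carrier L" "dual_pseudocomplement L a \<in> carrier L"
      by (simp_all add: pseudocomplement_RS pc_in_RS dual_pseudocomplement_RS dpc_in_RS)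
    fix b assume b: "b \<in> carrier L"
    show "a \<sqinter>\<^bsub>L\<^esub> b = ({}, {}) \<longleftrightarrow> b \<sqsubseteq>\<^bsub>L\<^esub> pseudocomplement L a"
      using a b meet_bottom_iff[of a b] pseudocomplement_RS[of a] bottom_RS by simp
    show "a \<squnion>\<^bsub>L\<^esub> b = (U, U) \<longleftrightarrow> dual_pseudocomplement L a \<sqsubseteq>\<^bsub>L\<^esub> b"
      using a b join_top_iff[of a b] dual_pseudocomplement_RS[of a] top_RS by simp
    assume "pseudocomplement L a = pseudocomplement L b"
      "dual_pseudocomplement L a = dual_pseudocomplement L b"
    \<comment> \<open>First coordinates of the two pseudocomplements suffice, since complementation
      is injective on subsets of \<open>U\<close>.\<close>
    then have "U - snd a = U - snd b" "U - fst a = U - fst b"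
      using a b by (simp_all add: pseudocomplement_RS dual_pseudocomplement_RS)
    moreover have "snd a \<subseteq> U" "snd b \<subseteq> U" "fst a \<subseteq> U" "fst b \<subseteq> U"
      using a b rough_pairD(1,7) by auto
    ultimately show "a = b"
      by (auto simp: prod_eq_iff)
  qed
qed

end

theorem theorem4p7:
  fixes U :: "'a set" and T E :: "'a rel" and C :: "'a set set"
  assumes "tolerance_on U T"
    and "irredundant_covering U C"
    and "T = induced_tolerance C"
    and "equiv U E"
    and "compatible E T"
    and "\<And>x. x \<in> Sigma_pts U E - Sigma_pts U T \<Longrightarrow> block U T (T `` {x}) \<Longrightarrow>
           \<exists>y\<in>U. y \<notin> Sigma_pts U E \<and> T `` {y} = T `` {x}"
  shows "regular_double_p_algebra (RS_order U E T)
           (pseudocomplement (RS_order U E T)) (dual_pseudocomplement (RS_order U E T))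
           ({}, {}) (U, U)"
proof -
  interpret irredundant_rough_sets U T E C
    using assms by unfold_locales
  show ?thesis
    by (rule regular_double_p_algebra_RS)
qed

end
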